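(* The variety $\mathsf{CM_G}$ has the finite embeddability property: for every algebra $\mathbf{A}\in\mathsf{CM_G}$ and every finite subset $B$ of $A$, there exists a finite algebra $\mathbf{C}\in\mathsf{CM_G}$ such that the partial subalgebra $\mathbf{B}$ of $\mathbf{A}$ induced by $B$ embeds in $\mathbf{C}$.
   Context: A residuated lattice is an algebra $(R,\wedge,\vee,\cdot,\backslash,/,1)$ such that $(R,\wedge,\vee)$ is a lattice, $(R,\cdot,1)$ is a monoid, and $xy\le z \iff y\le x\backslash z \iff x\le z/y$ for all $x,y,z$. For a group $\mathbf{G}$, $\mathbf{M}_{\mathbf{G}}$ is the residuated lattice on $G\cup\{\bot,\top\}$ in which $\bot$ is the bottom, $\top$ is the top, distinct elements of $G$ are incomparable, multiplication extends that of $\mathbf{G}$, $\bot$ is absorbing for all elements, and $\top x=x\top=\top$ for all $x\neq\bot$ (the divisions are uniquely determined). $\mathsf{M_G}$ is the variety generated by all $\mathbf{M}_{\mathbf{G}}$, $\mathbf{G}$ a group, and $\mathsf{CM_G}$ is the variety of commutative algebras in $\mathsf{M_G}$ (equivalently, the variety generated by all $\mathbf{M}_{\mathbf{G}}$ with $\mathbf{G}$ an abelian group). The partial subalgebra of $\mathbf{A}$ induced by $B$ has universe $B$, and each operation of $\mathbf{A}$ is defined on a tuple from $B$ exactly when its value in $\mathbf{A}$ lies in $B$. An embedding into $\mathbf{C}$ is an injective map preserving all operations whenever they are defined. *)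

theory Defs
  imports "HOL-Algebra.Generated_Groups" "HOL-Library.Countable_Set"
begin

section \<open>Residuated lattices\<close>

record 'a rlat = "'a monoid" +
  rmeet :: "'a \<Rightarrow> 'a \<Rightarrow> 'a" (infixl \<open>\<curlywedge>\<index>\<close> 70)
  rjoin :: "'a \<Rightarrow> 'a \<Rightarrow> 'a" (infixl \<open>\<curlyvee>\<index>\<close> 65)
  ldiv  :: "'a \<Rightarrow> 'a \<Rightarrow> 'a" (infixl \<open>\<setminus>\<index>\<close> 70)
  rdiv  :: "'a \<Rightarrow> 'a \<Rightarrow> 'a" (infixl \<open>\<sslash>\<index>\<close> 70)

definition rle :: "('a, 'b) rlat_scheme \<Rightarrow> 'a \<Rightarrow> 'a \<Rightarrow> bool" (infix \<open>\<preceq>\<index>\<close> 50)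
  where "x \<preceq>\<^bsub>R\<^esub> y \<longleftrightarrow> x \<curlywedge>\<^bsub>R\<^esub> y = x"

locale residuated_lattice = monoid R for R (structure) +
  assumes meet_closed: "\<lbrakk>x \<in> carrier R; y \<in> carrier R\<rbrakk> \<Longrightarrow> x \<curlywedge> y \<in> carrier R"
    and join_closed: "\<lbrakk>x \<in> carrier R; y \<in> carrier R\<rbrakk> \<Longrightarrow> x \<curlyvee> y \<in> carrier R"
    and ldiv_closed: "\<lbrakk>x \<in> carrier R; y \<in> carrier R\<rbrakk> \<Longrightarrow> x \<setminus> y \<in> carrier R"
    and rdiv_closed: "\<lbrakk>x \<in> carrier R; y \<in> carrier R\<rbrakk> \<Longrightarrow> x \<sslash> y \<in> carrier R"
    and meet_comm: "\<lbrakk>x \<in> carrier R; y \<in> carrier R\<rbrakk> \<Longrightarrow> x \<curlywedge> y = y \<curlywedge> x"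
    and join_comm: "\<lbrakk>x \<in> carrier R; y \<in> carrier R\<rbrakk> \<Longrightarrow> x \<curlyvee> y = y \<curlyvee> x"
    and meet_assoc: "\<lbrakk>x \<in> carrier R; y \<in> carrier R; z \<in> carrier R\<rbrakk>
          \<Longrightarrow> (x \<curlywedge> y) \<curlywedge> z = x \<curlywedge> (y \<curlywedge> z)"
    and join_assoc: "\<lbrakk>x \<in> carrier R; y \<in> carrier R; z \<in> carrier R\<rbrakk>
          \<Longrightarrow> (x \<curlyvee> y) \<curlyvee> z = x \<curlyvee> (y \<curlyvee> z)"
    and meet_join_absorb: "\<lbrakk>x \<in> carrier R; y \<in> carrier R\<rbrakk> \<Longrightarrow> x \<curlywedge> (x \<curlyvee> y) = x"
    and join_meet_absorb: "\<lbrakk>x \<in> carrier R; y \<in> carrier R\<rbrakk> \<Longrightarrow> x \<curlyvee> (x \<curlywedge> y) = x"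
    and ldiv_residuation: "\<lbrakk>x \<in> carrier R; y \<in> carrier R; z \<in> carrier R\<rbrakk>
          \<Longrightarrow> x \<otimes> y \<preceq> z \<longleftrightarrow> y \<preceq> x \<setminus> z"
    and rdiv_residuation: "\<lbrakk>x \<in> carrier R; y \<in> carrier R; z \<in> carrier R\<rbrakk>
          \<Longrightarrow> x \<otimes> y \<preceq> z \<longleftrightarrow> x \<preceq> z \<sslash> y"


section \<open>Equations and generated varieties\<close>

datatype rterm =
    RVar nat
  | ROne
  | RMeet rterm rterm
  | RJoin rterm rterm
  | RMult rterm rterm
  | RLdiv rterm rterm
  | RRdiv rterm rterm

primrec reval :: "('a, 'b) rlat_scheme \<Rightarrow> (nat \<Rightarrow> 'a) \<Rightarrow> rterm \<Rightarrow> 'a" where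
  "reval R v (RVar n) = v n"
| "reval R v ROne = \<one>\<^bsub>R\<^esub>"
| "reval R v (RMeet s t) = reval R v s \<curlywedge>\<^bsub>R\<^esub> reval R v t"
| "reval R v (RJoin s t) = reval R v s \<curlyvee>\<^bsub>R\<^esub> reval R v t"
| "reval R v (RMult s t) = reval R v s \<otimes>\<^bsub>R\<^esub> reval R v t"
| "reval R v (RLdiv s t) = reval R v s \<setminus>\<^bsub>R\<^esub> reval R v t"
| "reval R v (RRdiv s t) = reval R v s \<sslash>\<^bsub>R\<^esub> reval R v t"

definition satisfies :: "('a, 'b) rlat_scheme \<Rightarrow> rterm \<times> rterm \<Rightarrow> bool" (infix \<open>\<Turnstile>\<close> 50)
  where "R \<Turnstile> e \<longleftrightarrow> (\<forall>v. range v \<subseteq> carrier R \<longrightarrow> reval R v (fst e) = reval R v (snd e))"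

text \<open>The variety generated by \<^term>\<open>K\<close> is the least equational class containing \<^term>\<open>K\<close>: its
  members (over any type) satisfy every set of equations that holds throughout \<^term>\<open>K\<close>.\<close>

definition generated_variety :: "'k rlat set \<Rightarrow> 'a rlat set"
  where "generated_variety K =
    {A. residuated_lattice A \<and>
        (\<forall>E. (\<forall>M\<in>K. \<forall>e\<in>E. M \<Turnstile> e) \<longrightarrow> (\<forall>e\<in>E. A \<Turnstile> e))}"


section \<open>The algebras \<open>M\<^sub>G\<close> and the varieties they generate\<close>

datatype 'g ext = Bot | Elem 'g | Top

fun ext_meet :: "'g ext \<Rightarrow> 'g ext \<Rightarrow> 'g ext" where
  "ext_meet Top y = y"
| "ext_meet x Top = x"
| "ext_meet (Elem a) (Elem b) = (if a = b then Elem a else Bot)"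
| "ext_meet _ _ = Bot"

fun ext_join :: "'g ext \<Rightarrow> 'g ext \<Rightarrow> 'g ext" where
  "ext_join Bot y = y"
| "ext_join x Bot = x"
| "ext_join (Elem a) (Elem b) = (if a = b then Elem a else Top)"
| "ext_join _ _ = Top"

fun ext_mult :: "('g, 'b) monoid_scheme \<Rightarrow> 'g ext \<Rightarrow> 'g ext \<Rightarrow> 'g ext" where
  "ext_mult G (Elem a) (Elem b) = Elem (a \<otimes>\<^bsub>G\<^esub> b)"
| "ext_mult G Bot y = Bot"
| "ext_mult G x Bot = Bot"
| "ext_mult G _ _ = Top"

text \<open>The divisions are forced by residuation; see \<open>residuated_lattice_MG\<close> below.\<close>

fun ext_ldiv :: "('g, 'b) monoid_scheme \<Rightarrow> 'g ext \<Rightarrow> 'g ext \<Rightarrow> 'g ext" where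
  "ext_ldiv G (Elem a) (Elem b) = Elem (inv\<^bsub>G\<^esub> a \<otimes>\<^bsub>G\<^esub> b)"
| "ext_ldiv G Bot z = Top"
| "ext_ldiv G x Top = Top"
| "ext_ldiv G _ _ = Bot"

fun ext_rdiv :: "('g, 'b) monoid_scheme \<Rightarrow> 'g ext \<Rightarrow> 'g ext \<Rightarrow> 'g ext" where
  "ext_rdiv G (Elem b) (Elem a) = Elem (b \<otimes>\<^bsub>G\<^esub> inv\<^bsub>G\<^esub> a)"
| "ext_rdiv G z Bot = Top"
| "ext_rdiv G Top x = Top"
| "ext_rdiv G _ _ = Bot"

definition MG :: "('g, 'b) monoid_scheme \<Rightarrow> 'g ext rlat"
  where "MG G =
    \<lparr>carrier = {Bot, Top} \<union> Elem ` carrier G,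
     mult = ext_mult G, one = Elem \<one>\<^bsub>G\<^esub>,
     rmeet = ext_meet, rjoin = ext_join,
     ldiv = ext_ldiv G, rdiv = ext_rdiv G\<rparr>"

text \<open>Groups carried by sets of natural numbers suffice as generators, since refuting an equation
  involves only countably many group elements: by \<open>MG_in_MG_variety\<close> below, the variety so
  obtained contains \<^term>\<open>MG G\<close> for every group \<^term>\<open>G\<close> over every type.\<close>

definition MG_variety :: "'a rlat set"
  where "MG_variety = generated_variety {MG G | G :: nat monoid. group G}"

definition CMG_variety :: "'a rlat set"
  where "CMG_variety =
    {A \<in> MG_variety. \<forall>x\<in>carrier A. \<forall>y\<in>carrier A. x \<otimes>\<^bsub>A\<^esub> y = y \<otimes>\<^bsub>A\<^esub> x}"


section \<open>Embeddings of partial subalgebras\<close>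

definition preserves_op :: "'a set \<Rightarrow> ('a \<Rightarrow> 'c) \<Rightarrow> ('a \<Rightarrow> 'a \<Rightarrow> 'a) \<Rightarrow> ('c \<Rightarrow> 'c \<Rightarrow> 'c) \<Rightarrow> bool"
  where "preserves_op B f p q \<longleftrightarrow> (\<forall>x\<in>B. \<forall>y\<in>B. p x y \<in> B \<longrightarrow> f (p x y) = q (f x) (f y))"

definition partial_embedding :: "'a rlat \<Rightarrow> 'a set \<Rightarrow> 'c rlat \<Rightarrow> ('a \<Rightarrow> 'c) \<Rightarrow> bool"
  where "partial_embedding A B C f \<longleftrightarrow>
    f ` B \<subseteq> carrier C \<and> inj_on f B \<and>
    (\<one>\<^bsub>A\<^esub> \<in> B \<longrightarrow> f \<one>\<^bsub>A\<^esub> = \<one>\<^bsub>C\<^esub>) \<and>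
    preserves_op B f (rmeet A) (rmeet C) \<and>
    preserves_op B f (rjoin A) (rjoin C) \<and>
    preserves_op B f (mult A) (mult C) \<and>
    preserves_op B f (ldiv A) (ldiv C) \<and>
    preserves_op B f (rdiv A) (rdiv C)"


section \<open>Adequacy of the definitions\<close>

lemma MG_simps [simp]:
  "carrier (MG G) = {Bot, Top} \<union> Elem ` carrier G"
  "mult (MG G) = ext_mult G" "one (MG G) = Elem \<one>\<^bsub>G\<^esub>"
  "rmeet (MG G) = ext_meet" "rjoin (MG G) = ext_join"
  "ldiv (MG G) = ext_ldiv G" "rdiv (MG G) = ext_rdiv G"
  by (simp_all add: MG_def)

lemma residuated_lattice_MG:
  assumes "group G"
  shows "residuated_lattice (MG G)"
proof -
  interpret group G by fact
  have l: "inv\<^bsub>G\<^esub> a \<otimes>\<^bsub>G\<^esub> (a \<otimes>\<^bsub>G\<^esub> b) = b" "a \<otimes>\<^bsub>G\<^esub> (inv\<^bsub>G\<^esub> a \<otimes>\<^bsub>G\<^esub> b) = b"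
    if "a \<in> carrier G" "b \<in> carrier G" for a b
    using that by (simp_all flip: m_assoc)
  have r: "a \<otimes>\<^bsub>G\<^esub> b \<otimes>\<^bsub>G\<^esub> inv\<^bsub>G\<^esub> b = a" "a \<otimes>\<^bsub>G\<^esub> inv\<^bsub>G\<^esub> b \<otimes>\<^bsub>G\<^esub> b = a"
    if "a \<in> carrier G" "b \<in> carrier G" for a b
    using that by (simp_all add: m_assoc)
  show ?thesis
  proof (intro residuated_lattice.intro residuated_lattice_axioms.intro monoid.intro)
    fix x y z :: "'a ext"
    let ?M = "MG G"
    assume xyz: "x \<in> carrier ?M" "y \<in> carrier ?M" "z \<in> carrier ?M"
    then show "x \<otimes>\<^bsub>?M\<^esub> y \<otimes>\<^bsub>?M\<^esub> z = x \<otimes>\<^bsub>?M\<^esub> (y \<otimes>\<^bsub>?M\<^esub> z)"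
      by (cases x; cases y; cases z) (auto simp: m_assoc)
    show "x \<otimes>\<^bsub>?M\<^esub> y \<preceq>\<^bsub>?M\<^esub> z \<longleftrightarrow> y \<preceq>\<^bsub>?M\<^esub> x \<setminus>\<^bsub>?M\<^esub> z"
      using xyz by (cases x; cases y; cases z) (auto simp: rle_def l)
    show "x \<otimes>\<^bsub>?M\<^esub> y \<preceq>\<^bsub>?M\<^esub> z \<longleftrightarrow> x \<preceq>\<^bsub>?M\<^esub> z \<sslash>\<^bsub>?M\<^esub> y"
      using xyz by (cases x; cases y; cases z) (auto simp: rle_def r)
  qed (auto split: if_splits)
qed

lemma reval_MG_in_carrier:
  assumes "group G" "range v \<subseteq> carrier (MG G)"
  shows "reval (MG G) v t \<in> carrier (MG G)"
proof -
  interpret residuated_lattice "MG G" by (rule residuated_lattice_MG) fact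
  show ?thesis
    using assms(2)
    by (induction t)
      (use one_closed m_closed meet_closed join_closed ldiv_closed rdiv_closed in
        \<open>auto simp del: MG_simps simp: image_subset_iff\<close>)
qed

lemma reval_MG_map:
  assumes G: "group G" and H: "group H" and k: "k \<in> hom H G" "inj_on k (carrier H)"
    and v: "range v \<subseteq> carrier (MG H)"
  shows "reval (MG G) (\<lambda>n. map_ext k (v n)) t = map_ext k (reval (MG H) v t)"
proof -
  interpret group_hom H G k
    using G H k(1) by (simp add: group_hom_def group_hom_axioms_def)
  note c = reval_MG_in_carrier[OF H v]
  show ?thesis
  proof (induction t)
    case (RMeet s t)
    show ?case using c[of s] c[of t] inj_onD[OF k(2)]
      by (cases "reval (MG H) v s"; cases "reval (MG H) v t") (auto simp: RMeet)
  next
    case (RJoin s t)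
    show ?case using c[of s] c[of t] inj_onD[OF k(2)]
      by (cases "reval (MG H) v s"; cases "reval (MG H) v t") (auto simp: RJoin)
  next
    case (RMult s t)
    show ?case using c[of s] c[of t]
      by (cases "reval (MG H) v s"; cases "reval (MG H) v t") (auto simp: RMult)
  next
    case (RLdiv s t)
    show ?case using c[of s] c[of t]
      by (cases "reval (MG H) v s"; cases "reval (MG H) v t") (auto simp: RLdiv)
  next
    case (RRdiv s t)
    show ?case using c[of s] c[of t]
      by (cases "reval (MG H) v s"; cases "reval (MG H) v t") (auto simp: RRdiv)
  qed auto
qed

lemma countable_generate:
  assumes "group G" "X \<subseteq> carrier G" "countable X"
  shows "countable (generate G X)"
proof -
  interpret group G by fact
  let ?Y = "X \<union> m_inv G ` X"
  let ?w = "\<lambda>l. foldr (mult G) l \<one>\<^bsub>G\<^esub>"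
  have Y: "?Y \<subseteq> carrier G" using assms(2) by auto
  have wc: "?w l \<in> carrier G" if "set l \<subseteq> ?Y" for l
    using that Y by (induction l) auto
  have app: "?w (l @ l') = ?w l \<otimes>\<^bsub>G\<^esub> ?w l'" if "set l \<subseteq> ?Y" "set l' \<subseteq> ?Y" for l l'
    using that
  proof (induction l)
    case Nil
    then show ?case using wc by simp
  next
    case (Cons a l)
    have "a \<in> carrier G" using Cons.prems(1) Y by (meson list.set_intros(1) subsetD)
    moreover have "?w l \<in> carrier G" "?w l' \<in> carrier G" using wc Cons.prems by simp_all
    ultimately show ?case using Cons by (simp add: m_assoc)
  qed
  have "generate G X \<subseteq> ?w ` lists ?Y"
  proof
    fix x assume "x \<in> generate G X"
    then show "x \<in> ?w ` lists ?Y"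
    proof induction
      case one
      show ?case by (rule image_eqI[of _ _ "[]"]) auto
    next
      case (incl h)
      then show ?case using assms(2) by (intro image_eqI[of _ _ "[h]"]) auto
    next
      case (inv h)
      then show ?case using assms(2) by (intro image_eqI[of _ _ "[inv\<^bsub>G\<^esub> h]"]) auto
    next
      case (eng h1 h2)
      then obtain l l' where "h1 = ?w l" "set l \<subseteq> ?Y" "h2 = ?w l'" "set l' \<subseteq> ?Y"
        by (auto simp: lists_eq_set)
      then show ?case using app
        by (intro image_eqI[of _ _ "l @ l'"]) (auto simp: lists_eq_set)
    qed
  qed
  moreover have "countable (?w ` lists ?Y)"
    using assms(3) by simp
  ultimately show ?thesis by (rule countable_subset)
qed

theorem MG_in_MG_variety:
  fixes G :: "'g monoid"
  assumes "group G"
  shows "MG G \<in> MG_variety"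
proof -
  interpret G: group G by fact
  have "reval (MG G) v s = reval (MG G) v t"
    if nat: "\<And>H :: nat monoid. group H \<Longrightarrow> MG H \<Turnstile> (s, t)" and v: "range v \<subseteq> carrier (MG G)"
    for s t v
  proof -
    define X where "X = {g. Elem g \<in> range v}"
    have "X \<subseteq> carrier G" using v by (auto simp: X_def)
    moreover have "countable X"
    proof -
      have "countable (Elem ` X)"
        by (rule countable_subset[of _ "range v"]) (auto simp: X_def)
      then show ?thesis by (rule countable_image_inj_on) (simp add: inj_on_def)
    qed
    ultimately have S: "subgroup (generate G X) G" and cnt: "countable (generate G X)"
      using G.generate_is_subgroup countable_generate[OF assms] by auto
    define S where "S = generate G X"
    interpret S: subgroup S G using S by (simp add: S_def)
    define h where "h = to_nat_on S"
    define k where "k = inv_into S h"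
    have kh: "k (h x) = x" if "x \<in> S" for x
      using that cnt by (simp add: k_def h_def S_def inv_into_f_f inj_on_to_nat_on)
    define H where "H = \<lparr>carrier = h ` S, mult = (\<lambda>a b. h (k a \<otimes>\<^bsub>G\<^esub> k b)), one = h \<one>\<^bsub>G\<^esub>\<rparr>"
    have H: "group H"
    proof (rule groupI)
      fix x assume "x \<in> carrier H"
      then obtain a where "a \<in> S" "x = h a" by (auto simp: H_def)
      then show "\<exists>y\<in>carrier H. y \<otimes>\<^bsub>H\<^esub> x = \<one>\<^bsub>H\<^esub>"
        by (intro bexI[of _ "h (inv\<^bsub>G\<^esub> a)"]) (auto simp: H_def kh)
    qed (auto simp: H_def kh G.m_assoc)
    have hom: "k \<in> hom H G" by (auto simp: hom_def H_def kh)
    have inj: "inj_on k (carrier H)" by (auto simp: inj_on_def H_def kh)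
    define w where "w = map_ext h \<circ> v"
    have vS: "v n \<in> {Bot, Top} \<union> Elem ` S" for n
    proof (cases "v n")
      case (Elem g)
      then have "g \<in> X" by (auto simp: X_def intro: range_eqI[of _ _ n])
      then show ?thesis using Elem by (auto simp: S_def intro: generate.incl)
    qed auto
    have w: "range w \<subseteq> carrier (MG H)"
    proof (rule image_subsetI)
      fix n show "w n \<in> carrier (MG H)"
        using vS[of n] by (auto simp: w_def H_def)
    qed
    have "v = (\<lambda>n. map_ext k (w n))"
    proof
      fix n show "v n = map_ext k (w n)"
        using vS[of n] by (auto simp: w_def kh)
    qed
    then show ?thesis
      using reval_MG_map[OF assms H hom inj w] nat[OF H] w by (simp add: satisfies_def)
  qed
  then have "MG G \<Turnstile> e" if "\<And>H :: nat monoid. group H \<Longrightarrow> MG H \<Turnstile> e" for e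
    using that by (cases e) (simp add: satisfies_def[of "MG G"])
  then show ?thesis
    unfolding MG_variety_def generated_variety_def
    using residuated_lattice_MG[OF assms] by blast
qed

end

theory Submission
  imports Defs
begin

text \<open>
  The algebras \<open>M\<^sub>G\<close> behave like two-valued logic: for each equation \<open>s = t\<close> the term
  \<open>(s \ t) \<and> (t \ s) \<and> 1\<close> takes the value \<open>1\<close> in \<open>M\<^sub>G\<close> where the equation holds and \<open>\<bottom>\<close> where it fails.
  So every quasi-identity \<open>e\<^sub>1, \<dots>, e\<^sub>n \<Longrightarrow> s = t\<close> valid in all \<open>M\<^sub>G\<close> can be written as the single
  identity \<open>D \<and> d = D\<close>, where \<open>D\<close> is the meet of the terms of the premises and \<open>d\<close> is the term of
  the conclusion, and it therefore persists in the whole variety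
  (\<open>MG_variety_refutes_quasi_identity\<close>). This replaces the description of the subdirectly
  irreducible members by Jonsson's lemma.

  Now let \<open>B\<close> be a finite subset of a commutative \<open>A\<close> in the variety and let \<open>x \<noteq> y\<close> be in \<open>B\<close>.
  Give each element of \<open>B\<close> a variable and take as premises the operation table of the partial algebra
  \<open>B\<close> together with the commutation of any two of the variables. All of this holds in \<open>A\<close>, while
  \<open>x = y\<close> fails, so this quasi-identity fails in some \<open>M\<^sub>G\<close>: there is a map from \<open>B\<close> to \<open>M\<^sub>G\<close> which
  preserves the partial operations, has commuting values and separates \<open>x\<close> from \<open>y\<close>
  (\<open>separating_partial_hom_MG\<close>).

  The group elements among the finitely many values generate an abelian subgroup, and finitely
  generated abelian groups are residually finite: a finite set of elements can be mapped
  injectively into a finite abelian group \<open>K\<close> by a homomorphism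
  (\<open>commuting_finite_set_hom_finite_group\<close>). Injectivity on those elements is all that meets and
  joins need, so \<open>B\<close> is mapped to the finite algebra \<open>M\<^sub>K\<close>, with \<open>x\<close> and \<open>y\<close> still separated.
  The product of these algebras over all pairs \<open>x \<noteq> y\<close> in \<open>B\<close> is finite, lies in the variety and
  contains a copy of \<open>B\<close>.
\<close>


section \<open>Residual finiteness of finitely generated abelian groups\<close>

text \<open>
  Take \<open>N\<close> maximal among the subgroups disjoint from \<open>Z\<close>. If \<open>g\<close> had infinite order modulo \<open>N\<close>,
  then every subgroup \<open>N \<cdot> \<langle>g\<^sup>m\<rangle>\<close> with \<open>m > 0\<close> would properly contain \<open>N\<close> and hence meet \<open>Z\<close>. But
  each \<open>z \<in> Z\<close> lies in \<open>N g\<^sup>e\<close> for at most one exponent \<open>e\<close>, so only finitely many exponents occur.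
  The exponent \<open>0\<close> is not among them because \<open>N\<close> avoids \<open>Z\<close>, and no other multiple of a
  sufficiently large \<open>m\<close> is.
\<close>

lemma (in comm_group) torsion_quotient_avoiding_finite_set:
  assumes "finite Z" "\<one> \<notin> Z"
  obtains N where "subgroup N G" "N \<inter> Z = {}"
    "\<And>g. g \<in> carrier G \<Longrightarrow> \<exists>k>0. g [^] (k::nat) \<in> N"
proof -
  define \<A> where "\<A> = {N. subgroup N G \<and> N \<inter> Z = {}}"
  have "\<exists>M\<in>\<A>. \<forall>X\<in>\<A>. M \<subseteq> X \<longrightarrow> X = M"
  proof (rule subset_Zorn_nonempty)
    have "{\<one>} \<in> \<A>" using assms triv_subgroup by (simp add: \<A>_def)
    then show "\<A> \<noteq> {}" by blast
  next
    fix \<C> assume C: "\<C> \<noteq> {}" "subset.chain \<A> \<C>"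
    then have sub: "subgroup N G" "N \<inter> Z = {}" if "N \<in> \<C>" for N
      using that unfolding subset_chain_def \<A>_def by blast+
    have "subgroup (\<Union>\<C>) G"
    proof (rule subgroupI)
      show "\<Union>\<C> \<subseteq> carrier G" using sub(1) subgroup.subset by blast
      show "\<Union>\<C> \<noteq> {}" using C(1) sub(1) subgroup.one_closed by blast
      show "inv a \<in> \<Union>\<C>" if "a \<in> \<Union>\<C>" for a
        using that subgroup.m_inv_closed[OF sub(1), of _ a] by auto
      fix a b assume "a \<in> \<Union>\<C>" "b \<in> \<Union>\<C>"
      then obtain L M where LM: "L \<in> \<C>" "a \<in> L" "M \<in> \<C>" "b \<in> M" by blast
      then have "L \<subseteq> M \<or> M \<subseteq> L" using C(2) unfolding subset_chain_def by blast
      then show "a \<otimes> b \<in> \<Union>\<C>"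
        using LM sub(1) subgroup.m_closed by (metis UnionI subsetD)
    qed
    then show "\<Union>\<C> \<in> \<A>" using sub(2) unfolding \<A>_def by blast
  qed
  then obtain N where "N \<in> \<A>" and max: "\<forall>X\<in>\<A>. N \<subseteq> X \<longrightarrow> X = N" ..
  then have N: "subgroup N G" "N \<inter> Z = {}" by (auto simp: \<A>_def)
  interpret N: subgroup N G by fact
  have "\<exists>k>0. g [^] (k::nat) \<in> N" if g: "g \<in> carrier G" for g
  proof (rule ccontr)
    assume "\<not> ?thesis"
    then have nat: "g [^] k \<notin> N" if "k > 0" for k :: nat using that by blast
    have int: "k = 0" if "g [^] k \<in> N" for k :: int
    proof (cases k rule: int_cases2)
      case (nonneg n)
      then show ?thesis using nat[of n] that by (cases "n = 0") (auto simp: int_pow_int)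
    next
      case (nonpos n)
      then have "inv (g [^] n) \<in> N" using that g by (simp add: int_pow_neg_int)
      then have "inv (inv (g [^] n)) \<in> N" by (rule N.m_inv_closed)
      then show ?thesis using nat[of n] nonpos g by (cases "n = 0") auto
    qed
    \<comment> \<open>the exponents of \<open>g\<close> that occur in \<open>Z\<close> modulo \<open>N\<close>\<close>
    define S where "S = {e::int. \<exists>n\<in>N. n \<otimes> g [^] e \<in> Z}"
    have "finite S"
    proof -
      define p where "p e = (SOME z. z \<in> Z \<and> (\<exists>n\<in>N. z = n \<otimes> g [^] e))" for e :: int
      have p: "p e \<in> Z \<and> (\<exists>n\<in>N. p e = n \<otimes> g [^] e)" if "e \<in> S" for e
        unfolding p_def by (rule someI_ex) (use that in \<open>auto simp: S_def\<close>)
      have "inj_on p S"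
      proof (rule inj_onI)
        fix d e assume "d \<in> S" "e \<in> S" "p d = p e"
        then obtain n n' where n: "n \<in> N" "n' \<in> N" "n \<otimes> g [^] d = n' \<otimes> g [^] e"
          using p by metis
        then have "n \<otimes> g [^] (d - e) = n' \<otimes> (g [^] e \<otimes> inv (g [^] e))"
          using g n(1,2) by (metis int_pow_diff N.mem_carrier int_pow_closed inv_closed m_assoc n(3))
        then have "n \<otimes> g [^] (d - e) = n'" using g n(2) by (simp add: N.mem_carrier)
        then have "g [^] (d - e) = inv n \<otimes> n'"
          using g n(1,2) by (metis inv_solve_left int_pow_closed N.mem_carrier)
        then have "g [^] (d - e) \<in> N" using n by simp
        then show "d = e" using int by fastforce
      qed
      moreover have "p ` S \<subseteq> Z" using p by blast
      ultimately show ?thesis using assms(1) by (metis finite_imageD finite_subset)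
    qed
    \<comment> \<open>larger in absolute value than every exponent in \<open>S\<close>\<close>
    define m where "m = 1 + (\<Sum>e\<in>S. \<bar>e\<bar>)"
    have m: "\<bar>e\<bar> < m" if "e \<in> S" for e
      using that \<open>finite S\<close> member_le_sum[of e S abs] by (simp add: m_def)
    have "m > 0" unfolding m_def by (simp add: add_pos_nonneg sum_nonneg)
    define M where "M = N <#> generate G {g [^] m}"
    have sM: "subgroup M G"
      unfolding M_def using N(1) g by (intro mult_subgroups generate_is_subgroup) auto
    have Mi: "n \<otimes> g [^] (m * j) \<in> M" if "n \<in> N" for n j
      using that g generate_pow[of "g [^] m"] by (auto simp: M_def set_mult_def int_pow_pow)
    have "N \<subseteq> M"
      using Mi[of _ 0] N.mem_carrier by fastforce
    moreover have "g [^] m \<in> M" using Mi[of \<one> 1] g by simp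
    moreover have "g [^] m \<notin> N" using int[of m] \<open>m > 0\<close> by auto
    ultimately have "M \<inter> Z \<noteq> {}" using max sM unfolding \<A>_def by blast
    then obtain n j where z: "n \<in> N" "n \<otimes> g [^] (m * j) \<in> Z"
      using g generate_pow[of "g [^] m"] by (auto simp: M_def set_mult_def int_pow_pow)
    then have "m * j \<in> S" by (auto simp: S_def)
    moreover have "j \<noteq> 0" using z N N.mem_carrier by (auto)
    ultimately show False
      using m[of "m * j"] \<open>m > 0\<close> mult_left_mono[of 1 "\<bar>j\<bar>" m] by (simp add: abs_mult)
  qed
  with N show thesis by (rule that)
qed

text \<open>
  By induction on the generators: with \<open>x\<^sup>k = 1\<close>, the products \<open>a x\<^sup>n\<close> with \<open>a\<close> in the subgroup
  generated so far are closed under multiplication by commutativity, and the exponents matter only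
  modulo \<open>k\<close>.
\<close>

lemma (in comm_group) finite_generate_torsion:
  assumes "finite X" "X \<subseteq> carrier G" "\<And>x. x \<in> X \<Longrightarrow> \<exists>k>0. x [^] (k::nat) = \<one>"
  shows "finite (generate G X)"
  using assms
proof (induction X)
  case empty
  then show ?case by (simp add: generate_empty)
next
  case (insert x X)
  let ?H = "generate G X"
  obtain k :: nat where k: "k > 0" "x [^] k = \<one>" using insert.prems by blast
  have x: "x \<in> carrier G" and X: "X \<subseteq> carrier G" using insert.prems by auto
  interpret H: subgroup ?H G using generate_is_subgroup X by blast
  have mod: "x [^] n = x [^] (n mod k)" for n :: nat
  proof -
    have "x [^] n = x [^] (k * (n div k) + n mod k)" by simp
    also have "\<dots> = (x [^] k) [^] (n div k) \<otimes> x [^] (n mod k)"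
      using x by (simp only: nat_pow_mult[symmetric] nat_pow_pow)
    finally show ?thesis using x k by simp
  qed
  define T where "T = (\<lambda>(a, n). a \<otimes> x [^] (n::nat)) ` (?H \<times> UNIV)"
  have TI: "a \<otimes> x [^] n \<in> T" if "a \<in> ?H" for a and n :: nat
    using that by (auto simp: T_def)
  have "T \<subseteq> (\<lambda>(a, n). a \<otimes> x [^] n) ` (?H \<times> {..<k})"
  proof
    fix t assume "t \<in> T"
    then obtain a and n :: nat where "a \<in> ?H" "t = a \<otimes> x [^] n" by (auto simp: T_def)
    then show "t \<in> (\<lambda>(a, n). a \<otimes> x [^] n) ` (?H \<times> {..<k})"
      using mod[of n] k by (intro image_eqI[of _ _ "(a, n mod k)"]) auto
  qed
  moreover have "finite ?H" using insert.IH insert.prems by blast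
  ultimately have "finite T" by (meson finite_SigmaI finite_imageI finite_lessThan finite_subset)
  moreover have "generate G (insert x X) \<subseteq> T"
  proof
    fix y assume "y \<in> generate G (insert x X)"
    then show "y \<in> T"
    proof induction
      case one
      then show ?case using TI[of \<one> 0] by simp
    next
      case (incl h)
      then show ?case using TI[of \<one> 1] TI[of h 0] x X by (auto intro: generate.incl)
    next
      case (inv h)
      have "x [^] (k - 1) \<otimes> x = \<one>" using k by (metis Suc_diff_1 nat_pow_Suc)
      then have "inv x = x [^] (k - 1)" using x by (metis inv_equality nat_pow_closed)
      then show ?case
        using inv TI[of \<one> "k - 1"] TI[of "inv h" 0] x X by (auto intro: generate.inv)
    next
      case (eng h1 h2)
      then obtain a b and m n :: nat where "a \<in> ?H" "b \<in> ?H" "h1 = a \<otimes> x [^] m" "h2 = b \<otimes> x [^] n"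
        by (auto simp: T_def)
      moreover from this have "h1 \<otimes> h2 = (a \<otimes> b) \<otimes> x [^] (m + n)"
        using x by (simp add: m_ac H.mem_carrier flip: nat_pow_mult)
      ultimately show ?case using TI by simp
    qed
  qed
  ultimately show ?case by (rule finite_subset[rotated])
qed

text \<open>
  Whatever commutes with the generators commutes with all that they generate; this is applied once
  to each factor.
\<close>

lemma (in group) comm_group_generate:
  assumes X: "X \<subseteq> carrier G" and comm: "\<And>a b. a \<in> X \<Longrightarrow> b \<in> X \<Longrightarrow> a \<otimes> b = b \<otimes> a"
  shows "comm_group (G\<lparr>carrier := generate G X\<rparr>)"
proof -
  have centralizer: "a \<otimes> b = b \<otimes> a"
    if c: "\<And>x. x \<in> Y \<Longrightarrow> a \<otimes> x = x \<otimes> a" and a: "a \<in> carrier G" and Y: "Y \<subseteq> carrier G"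
      and b: "b \<in> generate G Y" for a b Y
    using b
  proof induction
    case (inv h)
    then have h: "h \<in> carrier G" using Y by auto
    have "a = h \<otimes> a \<otimes> inv h" using c[OF inv] a h by (simp add: m_assoc flip: c[OF inv])
    then show ?case using a h by (metis inv_solve_left inv_closed m_assoc m_closed)
  next
    case (eng h1 h2)
    then have "h1 \<in> carrier G" "h2 \<in> carrier G" using Y generate_in_carrier by auto
    then show ?case using eng.IH a by (metis m_assoc)
  qed (use a c in auto)
  have "a \<otimes> b = b \<otimes> a" if a: "a \<in> generate G X" and b: "b \<in> generate G X" for a b
  proof (rule centralizer[OF _ generate_in_carrier[OF X a] X b])
    fix x assume x: "x \<in> X"
    then have "x \<otimes> a = a \<otimes> x"
      using X by (intro centralizer[OF comm[OF x] _ X a]) blast+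
    then show "a \<otimes> x = x \<otimes> a" by simp
  qed
  moreover have "subgroup (generate G X) G" using X by (rule generate_is_subgroup)
  ultimately show ?thesis
    by (intro group.group_comm_groupI subgroup_imp_group) auto
qed


text \<open>
  A quotient of the generated subgroup by \<open>N\<close> is injective on \<open>X\<close> as soon as \<open>N\<close> avoids the
  finitely many elements \<open>a b\<^sup>-\<^sup>1\<close> with \<open>a \<noteq> b\<close> in \<open>X\<close>. Choosing \<open>N\<close> with torsion quotient makes
  that quotient finite, because it is generated by the image of \<open>X\<close>.
\<close>

lemma (in group) commuting_finite_set_hom_finite_group:
  assumes X: "finite X" "X \<subseteq> carrier G"
    and comm: "\<And>a b. a \<in> X \<Longrightarrow> b \<in> X \<Longrightarrow> a \<otimes> b = b \<otimes> a"
  obtains K :: "'a set monoid" and \<phi> where "comm_group K" "finite (carrier K)"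
    "\<phi> \<in> hom (G\<lparr>carrier := generate G X\<rparr>) K" "inj_on \<phi> X"
proof -
  define H where "H = G\<lparr>carrier := generate G X\<rparr>"
  interpret H: comm_group H unfolding H_def using X(2) comm by (rule comm_group_generate)
  have XH: "X \<subseteq> carrier H" by (auto simp: H_def intro: generate.incl)
  have gen: "generate H X = carrier H"
    using generate_consistent[OF _ generate_is_subgroup[OF X(2)], of X] XH by (simp add: H_def)
  define Z where "Z = (\<lambda>(a, b). a \<otimes>\<^bsub>H\<^esub> inv\<^bsub>H\<^esub> b) ` {(a, b) \<in> X \<times> X. a \<noteq> b}"
  have "finite Z"
    unfolding Z_def by (rule finite_imageI, rule finite_subset[of _ "X \<times> X"]) (use X(1) in auto)
  moreover have "\<one>\<^bsub>H\<^esub> \<notin> Z"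
  proof
    assume "\<one>\<^bsub>H\<^esub> \<in> Z"
    then obtain a b where ab: "a \<in> X" "b \<in> X" "a \<noteq> b" "\<one>\<^bsub>H\<^esub> = a \<otimes>\<^bsub>H\<^esub> inv\<^bsub>H\<^esub> b"
      by (auto simp: Z_def)
    moreover have "a \<in> carrier H" "b \<in> carrier H" using ab XH by auto
    ultimately show False by (metis H.inv_closed H.inv_equality H.inv_inv)
  qed
  ultimately obtain N where N: "subgroup N H" "N \<inter> Z = {}"
    and torsion: "\<And>g. g \<in> carrier H \<Longrightarrow> \<exists>k>0. g [^]\<^bsub>H\<^esub> (k::nat) \<in> N"
    using H.torsion_quotient_avoiding_finite_set by metis
  interpret N: normal N H using N(1) by (rule H.subgroup_imp_normal)
  define \<phi> where "\<phi> a = N #>\<^bsub>H\<^esub> a" for a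
  interpret K: group "H Mod N" by (rule N.factorgroup_is_group)
  interpret \<phi>: group_hom H "H Mod N" \<phi>
    using N.r_coset_hom_Mod by unfold_locales (simp add: \<phi>_def[abs_def])
  have onto: "carrier (H Mod N) = \<phi> ` carrier H"
    by (auto simp: FactGroup_def RCOSETS_def \<phi>_def)
  interpret K: comm_group "H Mod N"
  proof (rule K.group_comm_groupI)
    fix x y assume "x \<in> carrier (H Mod N)" "y \<in> carrier (H Mod N)"
    then obtain a b where ab: "a \<in> carrier H" "b \<in> carrier H" and "x = \<phi> a" "y = \<phi> b"
      unfolding onto by blast
    then show "x \<otimes>\<^bsub>H Mod N\<^esub> y = y \<otimes>\<^bsub>H Mod N\<^esub> x"
      using H.m_comm[OF ab] by (metis \<phi>.hom_mult)
  qed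
  have "finite (generate (H Mod N) (\<phi> ` X))"
  proof (rule K.finite_generate_torsion)
    fix y assume "y \<in> \<phi> ` X"
    then obtain a where a: "a \<in> carrier H" "y = \<phi> a" using XH by blast
    then obtain k :: nat where k: "k > 0" "a [^]\<^bsub>H\<^esub> k \<in> N" using torsion by blast
    have "y [^]\<^bsub>H Mod N\<^esub> k = \<phi> (a [^]\<^bsub>H\<^esub> k)" using a by (simp add: \<phi>.hom_nat_pow)
    also have "\<dots> = \<one>\<^bsub>H Mod N\<^esub>"
      using H.coset_join2[OF _ N(1) k(2)] a by (simp add: \<phi>_def FactGroup_def)
    finally show "\<exists>k>0. y [^]\<^bsub>H Mod N\<^esub> (k::nat) = \<one>\<^bsub>H Mod N\<^esub>" using k(1) by blast
  qed (use X(1) XH in auto)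
  then have "finite (carrier (H Mod N))"
    using \<phi>.generate_img[OF XH] by (simp add: onto gen)
  moreover have "inj_on \<phi> X"
  proof (rule inj_onI, rule ccontr)
    fix a b assume ab: "a \<in> X" "b \<in> X" "\<phi> a = \<phi> b" "a \<noteq> b"
    then have c: "a \<in> carrier H" "b \<in> carrier H" using XH by auto
    have "a \<in> N #>\<^bsub>H\<^esub> b"
      using H.repr_independenceD[OF N(1) c(1), of b] ab(3) by (simp add: \<phi>_def)
    then obtain n where "n \<in> N" "a = n \<otimes>\<^bsub>H\<^esub> b" by (auto simp: r_coset_def)
    then have "a \<otimes>\<^bsub>H\<^esub> inv\<^bsub>H\<^esub> b \<in> N" using c by (simp add: H.m_assoc)
    moreover have "a \<otimes>\<^bsub>H\<^esub> inv\<^bsub>H\<^esub> b \<in> Z" using ab by (auto simp: Z_def)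
    ultimately show False using N(2) by blast
  qed
  ultimately show thesis
    using K.comm_group_axioms \<phi>.homh unfolding H_def by (intro that)
qed

section \<open>Quasi-identities as identities\<close>

lemma (in residuated_lattice) reval_closed:
  assumes "range v \<subseteq> carrier R"
  shows "reval R v t \<in> carrier R"
  using assms
  by (induction t)
    (auto intro: one_closed m_closed meet_closed join_closed ldiv_closed rdiv_closed)

lemma (in residuated_lattice) meet_idem: "x \<in> carrier R \<Longrightarrow> x \<curlywedge> x = x"
  by (metis join_meet_absorb meet_join_absorb meet_closed)

lemma (in residuated_lattice) one_rle_ldiv_iff:
  assumes "x \<in> carrier R" "y \<in> carrier R"
  shows "\<one> \<preceq> x \<setminus> y \<longleftrightarrow> x \<preceq> y"
  using ldiv_residuation[OF assms(1) one_closed assms(2)] assms by simp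

lemma (in residuated_lattice) rle_antisym:
  assumes "x \<in> carrier R" "y \<in> carrier R" "x \<preceq> y" "y \<preceq> x"
  shows "x = y"
  using assms meet_comm by (simp add: rle_def)

text \<open>
  The truth value of an equation: in every residuated lattice it is \<open>1\<close> exactly when the equation
  holds, and in \<open>M\<^sub>G\<close> its only other value is \<open>\<bottom>\<close>.
\<close>

definition equality_term :: "rterm \<times> rterm \<Rightarrow> rterm"
  where "equality_term e =
    RMeet (RMeet (RLdiv (fst e) (snd e)) (RLdiv (snd e) (fst e))) ROne"

definition conjunction_term :: "(rterm \<times> rterm) list \<Rightarrow> rterm"
  where "conjunction_term es = foldr (\<lambda>e. RMeet (equality_term e)) es ROne"

lemma (in residuated_lattice) reval_equality_term_eq_one_iff:
  assumes v: "range v \<subseteq> carrier R"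
  shows "reval R v (equality_term e) = \<one> \<longleftrightarrow> reval R v (fst e) = reval R v (snd e)"
proof -
  let ?x = "reval R v (fst e)" and ?y = "reval R v (snd e)"
  let ?p = "?x \<setminus> ?y" and ?q = "?y \<setminus> ?x"
  have c: "?x \<in> carrier R" "?y \<in> carrier R" using reval_closed[OF v] by auto
  then have pq: "?p \<in> carrier R" "?q \<in> carrier R" by (auto intro: ldiv_closed)
  show ?thesis
  proof
    assume "reval R v (equality_term e) = \<one>"
    then have one: "?p \<curlywedge> ?q \<curlywedge> \<one> = \<one>" by (simp add: equality_term_def)
    have "\<one> \<curlywedge> ?p = \<one>" "\<one> \<curlywedge> ?q = \<one>"
      using one pq meet_comm meet_assoc meet_idem one_closed meet_closed by metis+
    then have "\<one> \<preceq> ?p" "\<one> \<preceq> ?q" by (simp_all add: rle_def)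
    then show "?x = ?y" using c by (simp add: one_rle_ldiv_iff rle_antisym)
  next
    assume eq: "?x = ?y"
    have "\<one> \<preceq> ?p" using c meet_idem by (simp add: one_rle_ldiv_iff eq) (simp add: rle_def)
    then show "reval R v (equality_term e) = \<one>"
      using eq pq meet_idem meet_comm one_closed by (simp add: equality_term_def rle_def)
  qed
qed

lemma (in residuated_lattice) reval_conjunction_term_eq_one:
  assumes v: "range v \<subseteq> carrier R"
    and "\<forall>e\<in>set es. reval R v (fst e) = reval R v (snd e)"
  shows "reval R v (conjunction_term es) = \<one>"
  using assms(2)
proof (induction es)
  case (Cons e es)
  then have "reval R v (equality_term e) = \<one>"
    using reval_equality_term_eq_one_iff[OF v] by simp
  then show ?case using Cons by (simp add: conjunction_term_def meet_idem)
qed (simp add: conjunction_term_def)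

text \<open>
  If \<open>a \<noteq> b\<close> in \<open>G\<close>, then \<open>a \ b\<close> is a group element other than \<open>1\<close>, so its meet with \<open>1\<close> is \<open>\<bottom>\<close>;
  if one of two distinct elements is \<open>\<bottom>\<close> or \<open>\<top>\<close>, one of the two divisions already gives \<open>\<bottom>\<close>.
\<close>

lemma reval_MG_equality_term:
  assumes "group G" "range v \<subseteq> carrier (MG G)"
  shows "reval (MG G) v (equality_term e) =
    (if reval (MG G) v (fst e) = reval (MG G) v (snd e) then Elem \<one>\<^bsub>G\<^esub> else Bot)"
proof -
  interpret group G by fact
  have inv: "inv\<^bsub>G\<^esub> a \<otimes>\<^bsub>G\<^esub> b = \<one>\<^bsub>G\<^esub> \<longleftrightarrow> a = b" if "a \<in> carrier G" "b \<in> carrier G" for a b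
    using that by (metis inv_closed inv_equality inv_inv l_inv)
  show ?thesis
    using reval_MG_in_carrier[OF assms, of "fst e"] reval_MG_in_carrier[OF assms, of "snd e"]
    by (cases "reval (MG G) v (fst e)"; cases "reval (MG G) v (snd e)")
      (auto simp: equality_term_def inv)
qed

lemma reval_MG_conjunction_term:
  assumes "group G" "range v \<subseteq> carrier (MG G)"
  shows "reval (MG G) v (conjunction_term es) =
    (if \<forall>e\<in>set es. reval (MG G) v (fst e) = reval (MG G) v (snd e) then Elem \<one>\<^bsub>G\<^esub> else Bot)"
  by (induction es) (auto simp: conjunction_term_def reval_MG_equality_term[OF assms])

text \<open>
  A quasi-identity that fails somewhere in the variety already fails in a generator. Otherwise
  \<open>D \<and> d = D\<close> holds in every generator, since there \<open>D\<close> is \<open>\<bottom>\<close> or both sides are \<open>1\<close>. Hence it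
  holds in \<open>A\<close>, where \<open>D = 1\<close> by the premises and so \<open>d = 1\<close>, which says \<open>s = t\<close>.
\<close>

lemma MG_variety_refutes_quasi_identity:
  assumes A: "A \<in> MG_variety" and v: "range v \<subseteq> carrier A"
    and prem: "\<forall>e\<in>set es. reval A v (fst e) = reval A v (snd e)"
    and concl: "reval A v s \<noteq> reval A v t"
  obtains G :: "nat monoid" and w where "group G" "range w \<subseteq> carrier (MG G)"
    "\<forall>e\<in>set es. reval (MG G) w (fst e) = reval (MG G) w (snd e)"
    "reval (MG G) w s \<noteq> reval (MG G) w t"
proof (rule ccontr)
  note refutation = that
  assume neg: "\<not> thesis"
  let ?D = "conjunction_term es" and ?d = "equality_term (s, t)"
  let ?e = "(RMeet ?D ?d, ?D)"
  have valid: "MG G \<Turnstile> ?e" if G: "group G" for G :: "nat monoid"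
    unfolding satisfies_def
  proof (intro allI impI)
    fix w :: "nat \<Rightarrow> nat ext" assume w: "range w \<subseteq> carrier (MG G)"
    have "reval (MG G) w s = reval (MG G) w t"
      if "\<forall>e\<in>set es. reval (MG G) w (fst e) = reval (MG G) w (snd e)"
      using refutation[OF G w that] neg by auto
    then show "reval (MG G) w (fst ?e) = reval (MG G) w (snd ?e)"
      by (auto simp: reval_MG_conjunction_term[OF G w] reval_MG_equality_term[OF G w])
  qed
  interpret A: residuated_lattice A
    using A by (simp add: MG_variety_def generated_variety_def)
  have "\<forall>E. (\<forall>M\<in>{MG G |G :: nat monoid. group G}. \<forall>e\<in>E. M \<Turnstile> e) \<longrightarrow> (\<forall>e\<in>E. A \<Turnstile> e)"
    using A by (simp add: MG_variety_def generated_variety_def)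
  from this[rule_format, of "{?e}" ?e] have "A \<Turnstile> ?e" using valid by auto
  then have "reval A v ?D \<curlywedge>\<^bsub>A\<^esub> reval A v ?d = reval A v ?D"
    using v by (simp add: satisfies_def)
  then have "\<one>\<^bsub>A\<^esub> \<curlywedge>\<^bsub>A\<^esub> reval A v ?d = \<one>\<^bsub>A\<^esub>"
    using A.reval_conjunction_term_eq_one[OF v prem] by simp
  moreover have "reval A v ?d \<curlywedge>\<^bsub>A\<^esub> \<one>\<^bsub>A\<^esub> = reval A v ?d"
    using A.reval_closed[OF v] A.meet_assoc A.meet_idem
    by (simp add: equality_term_def A.meet_closed A.ldiv_closed)
  ultimately have "reval A v ?d = \<one>\<^bsub>A\<^esub>"
    using A.meet_comm[OF A.one_closed A.reval_closed[OF v]] by metis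
  then show False using concl A.reval_equality_term_eq_one_iff[OF v] by simp
qed


section \<open>Separating two elements by a partial homomorphism\<close>

text \<open>
  A partial embedding without injectivity: maps that separate only some points of \<open>B\<close> are the
  coordinates from which the embedding into a product is assembled.
\<close>

definition partial_hom :: "'a rlat \<Rightarrow> 'a set \<Rightarrow> 'c rlat \<Rightarrow> ('a \<Rightarrow> 'c) \<Rightarrow> bool"
  where "partial_hom A B C f \<longleftrightarrow>
    f ` B \<subseteq> carrier C \<and>
    (\<one>\<^bsub>A\<^esub> \<in> B \<longrightarrow> f \<one>\<^bsub>A\<^esub> = \<one>\<^bsub>C\<^esub>) \<and>
    preserves_op B f (rmeet A) (rmeet C) \<and>
    preserves_op B f (rjoin A) (rjoin C) \<and>
    preserves_op B f (mult A) (mult C) \<and>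
    preserves_op B f (ldiv A) (ldiv C) \<and>
    preserves_op B f (rdiv A) (rdiv C)"

definition op_diagram ::
    "'a set \<Rightarrow> ('a \<Rightarrow> nat) \<Rightarrow> ('a \<Rightarrow> 'a \<Rightarrow> 'a) \<Rightarrow> (rterm \<Rightarrow> rterm \<Rightarrow> rterm) \<Rightarrow> (rterm \<times> rterm) set"
  where "op_diagram B ix p T =
    (\<lambda>(x, y). (T (RVar (ix x)) (RVar (ix y)), RVar (ix (p x y)))) ` {(x, y) \<in> B \<times> B. p x y \<in> B}"

text \<open>
  The positive diagram of the partial algebra induced by \<open>B\<close>, with the variable \<open>ix b\<close> naming \<open>b\<close>.
  Its solutions in an algebra are the partial homomorphisms from \<open>B\<close> to that algebra.
\<close>

definition diagram :: "'a rlat \<Rightarrow> 'a set \<Rightarrow> ('a \<Rightarrow> nat) \<Rightarrow> (rterm \<times> rterm) set"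
  where "diagram A B ix =
    (\<lambda>u. (ROne, RVar (ix u))) ` ({\<one>\<^bsub>A\<^esub>} \<inter> B) \<union>
    op_diagram B ix (rmeet A) RMeet \<union> op_diagram B ix (rjoin A) RJoin \<union>
    op_diagram B ix (mult A) RMult \<union> op_diagram B ix (ldiv A) RLdiv \<union>
    op_diagram B ix (rdiv A) RRdiv"

lemma finite_diagram:
  assumes "finite B"
  shows "finite (diagram A B ix)"
proof -
  have "finite (op_diagram B ix p T)" for p T
    unfolding op_diagram_def
    by (rule finite_imageI, rule finite_subset[of _ "B \<times> B"]) (use assms in auto)
  then show ?thesis by (simp add: diagram_def)
qed

lemma diagram_holds:
  assumes "\<And>b. b \<in> B \<Longrightarrow> v (ix b) = b" "e \<in> diagram A B ix"
  shows "reval A v (fst e) = reval A v (snd e)"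
  using assms by (auto simp: diagram_def op_diagram_def)

lemma partial_hom_of_diagram:
  assumes "range w \<subseteq> carrier C"
    and "\<forall>e\<in>diagram A B ix. reval C w (fst e) = reval C w (snd e)"
  shows "partial_hom A B C (\<lambda>b. w (ix b))"
proof -
  have op: "preserves_op B (\<lambda>b. w (ix b)) p q"
    if "op_diagram B ix p T \<subseteq> diagram A B ix"
      and T: "\<And>m n. reval C w (T (RVar m) (RVar n)) = q (w m) (w n)" for p q T
    unfolding preserves_op_def
  proof (intro ballI impI)
    fix x y assume "x \<in> B" "y \<in> B" "p x y \<in> B"
    then have "(T (RVar (ix x)) (RVar (ix y)), RVar (ix (p x y))) \<in> op_diagram B ix p T"
      by (force simp: op_diagram_def)
    then show "w (ix (p x y)) = q (w (ix x)) (w (ix y))"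
      using assms(2) that by fastforce
  qed
  show ?thesis
    unfolding partial_hom_def
  proof (intro conjI)
    show "\<one>\<^bsub>A\<^esub> \<in> B \<longrightarrow> w (ix \<one>\<^bsub>A\<^esub>) = \<one>\<^bsub>C\<^esub>"
    proof
      assume "\<one>\<^bsub>A\<^esub> \<in> B"
      then have "(ROne, RVar (ix \<one>\<^bsub>A\<^esub>)) \<in> diagram A B ix" by (auto simp: diagram_def)
      then show "w (ix \<one>\<^bsub>A\<^esub>) = \<one>\<^bsub>C\<^esub>" using assms(2) by fastforce
    qed
    show "(\<lambda>b. w (ix b)) ` B \<subseteq> carrier C" using assms(1) by auto
    show "preserves_op B (\<lambda>b. w (ix b)) (rmeet A) (rmeet C)"
      by (rule op[of _ RMeet]) (auto simp: diagram_def)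
    show "preserves_op B (\<lambda>b. w (ix b)) (rjoin A) (rjoin C)"
      by (rule op[of _ RJoin]) (auto simp: diagram_def)
    show "preserves_op B (\<lambda>b. w (ix b)) (mult A) (mult C)"
      by (rule op[of _ RMult]) (auto simp: diagram_def)
    show "preserves_op B (\<lambda>b. w (ix b)) (ldiv A) (ldiv C)"
      by (rule op[of _ RLdiv]) (auto simp: diagram_def)
    show "preserves_op B (\<lambda>b. w (ix b)) (rdiv A) (rdiv C)"
      by (rule op[of _ RRdiv]) (auto simp: diagram_def)
  qed
qed

text \<open>
  The quasi-identity to refute has as premises the diagram of \<open>B\<close> and the commutation of its
  variables. Commutation must be imposed on the variables because the generators of the variety
  include \<open>M\<^sub>G\<close> for non-abelian \<open>G\<close>.
\<close>

lemma separating_partial_hom_MG: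
  assumes A: "A \<in> CMG_variety" and B: "B \<subseteq> carrier A" "finite B"
    and xy: "x \<in> B" "y \<in> B" "x \<noteq> y"
  obtains G :: "nat monoid" and f where "group G" "partial_hom A B (MG G) f" "f x \<noteq> f y"
    "\<And>a b. a \<in> B \<Longrightarrow> b \<in> B \<Longrightarrow> ext_mult G (f a) (f b) = ext_mult G (f b) (f a)"
proof -
  define ix where "ix = to_nat_on B"
  define v where "v = from_nat_into B"
  have v: "v (ix b) = b" if "b \<in> B" for b
    using that B(2) by (simp add: v_def ix_def countable_finite)
  have rv: "range v \<subseteq> carrier A" using B(1) xy(1) from_nat_into[of B] by (auto simp: v_def)
  let ?comm = "(\<lambda>(a, b). (RMult (RVar (ix a)) (RVar (ix b)), RMult (RVar (ix b)) (RVar (ix a))))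
    ` (B \<times> B)"
  have "finite (diagram A B ix \<union> ?comm)" using finite_diagram[OF B(2)] B(2) by blast
  from finite_list[OF this] obtain es where es: "set es = diagram A B ix \<union> ?comm" ..
  have A': "A \<in> MG_variety" using A by (simp add: CMG_variety_def)
  have prem: "\<forall>e\<in>set es. reval A v (fst e) = reval A v (snd e)"
  proof
    fix e assume "e \<in> set es"
    then consider "e \<in> diagram A B ix" | "e \<in> ?comm" unfolding es by blast
    then show "reval A v (fst e) = reval A v (snd e)"
    proof cases
      case 1
      then show ?thesis using diagram_holds[OF v] by blast
    next
      case 2
      then obtain a b where ab: "a \<in> B" "b \<in> B"
        and e: "e = (RMult (RVar (ix a)) (RVar (ix b)), RMult (RVar (ix b)) (RVar (ix a)))" by auto
      have "a \<otimes>\<^bsub>A\<^esub> b = b \<otimes>\<^bsub>A\<^esub> a"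
        using A B(1) ab unfolding CMG_variety_def by blast
      then show ?thesis by (simp add: e v ab)
    qed
  qed
  have concl: "reval A v (RVar (ix x)) \<noteq> reval A v (RVar (ix y))" using xy v by simp
  obtain G :: "nat monoid" and w where G: "group G" and w: "range w \<subseteq> carrier (MG G)"
    and d: "\<forall>e\<in>set es. reval (MG G) w (fst e) = reval (MG G) w (snd e)"
    and ne: "reval (MG G) w (RVar (ix x)) \<noteq> reval (MG G) w (RVar (ix y))"
    by (rule MG_variety_refutes_quasi_identity[OF A' rv prem concl])
  show thesis
  proof (rule that[OF G])
    show "partial_hom A B (MG G) (\<lambda>b. w (ix b))"
      using d es by (intro partial_hom_of_diagram[OF w]) blast
    show "w (ix x) \<noteq> w (ix y)" using ne by simp
    fix a b assume "a \<in> B" "b \<in> B"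
    then have "(RMult (RVar (ix a)) (RVar (ix b)), RMult (RVar (ix b)) (RVar (ix a))) \<in> set es"
      unfolding es by (intro UnI2 image_eqI[of _ _ "(a, b)"]) auto
    from d[rule_format, OF this]
    show "ext_mult G (w (ix a)) (w (ix b)) = ext_mult G (w (ix b)) (w (ix a))" by simp
  qed
qed

text \<open>
  The group operations survive any homomorphism, but the meet and join of two group elements
  depend on whether these are equal, which is why \<open>\<phi>\<close> has to be injective on the group elements
  that occur as values of \<open>f\<close>.
\<close>

lemma partial_hom_map_ext:
  assumes G: "group G" and S: "subgroup S G" and K: "group K"
    and \<phi>: "\<phi> \<in> hom (G\<lparr>carrier := S\<rparr>) K"
    and f: "partial_hom A B (MG G) f"
    and XS: "{g. Elem g \<in> f ` B} \<subseteq> S" and inj: "inj_on \<phi> {g. Elem g \<in> f ` B}"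
  shows "partial_hom A B (MG K) (\<lambda>b. map_ext \<phi> (f b))"
proof -
  interpret G: group G by fact
  interpret S: subgroup S G by fact
  interpret \<phi>: group_hom "G\<lparr>carrier := S\<rparr>" K \<phi>
    using G.subgroup_imp_group[OF S] K \<phi> by (simp add: group_hom_def group_hom_axioms_def)
  have mult: "\<phi> (a \<otimes>\<^bsub>G\<^esub> b) = \<phi> a \<otimes>\<^bsub>K\<^esub> \<phi> b" if "a \<in> S" "b \<in> S" for a b
    using \<phi>.hom_mult[of a b] that by simp
  have inv: "\<phi> (inv\<^bsub>G\<^esub> a) = inv\<^bsub>K\<^esub> \<phi> a" if "a \<in> S" for a
    using \<phi>.hom_inv[of a] that G.m_inv_consistent[OF S] by simp
  have S: "a \<in> S" if "f b = Elem a" "b \<in> B" for a b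
    using that XS by (metis (mono_tags) image_eqI mem_Collect_eq subsetD)
  have inj: "\<phi> a = \<phi> a' \<longleftrightarrow> a = a'"
    if "f b = Elem a" "b \<in> B" "f b' = Elem a'" "b' \<in> B" for a a' b b'
    using inj_on_eq_iff[OF inj, of a a'] that by (metis (mono_tags) image_eqI mem_Collect_eq)
  have op: "preserves_op B (\<lambda>b. map_ext \<phi> (f b)) p q'"
    if "preserves_op B f p q"
      "\<And>b b'. b \<in> B \<Longrightarrow> b' \<in> B \<Longrightarrow>
        map_ext \<phi> (q (f b) (f b')) = q' (map_ext \<phi> (f b)) (map_ext \<phi> (f b'))" for p q q'
    using that by (simp add: preserves_op_def)
  show ?thesis
    unfolding partial_hom_def MG_simps
  proof (intro conjI)
    show "(\<lambda>b. map_ext \<phi> (f b)) ` B \<subseteq> {Bot, Top} \<union> Elem ` carrier K"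
    proof (rule image_subsetI)
      fix b assume "b \<in> B"
      then show "map_ext \<phi> (f b) \<in> {Bot, Top} \<union> Elem ` carrier K"
        using S[of b] \<phi>.hom_closed by (cases "f b") auto
    qed
    show "\<one>\<^bsub>A\<^esub> \<in> B \<longrightarrow> map_ext \<phi> (f \<one>\<^bsub>A\<^esub>) = Elem \<one>\<^bsub>K\<^esub>"
      using f \<phi>.hom_one by (simp add: partial_hom_def)
    show "preserves_op B (\<lambda>b. map_ext \<phi> (f b)) (rmeet A) ext_meet"
    proof (rule op)
      fix b b' assume "b \<in> B" "b' \<in> B"
      then show "map_ext \<phi> (ext_meet (f b) (f b')) = ext_meet (map_ext \<phi> (f b)) (map_ext \<phi> (f b'))"
        using inj[of b _ b'] by (cases "f b"; cases "f b'") auto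
    qed (use f in \<open>simp add: partial_hom_def\<close>)
    show "preserves_op B (\<lambda>b. map_ext \<phi> (f b)) (rjoin A) ext_join"
    proof (rule op)
      fix b b' assume "b \<in> B" "b' \<in> B"
      then show "map_ext \<phi> (ext_join (f b) (f b')) = ext_join (map_ext \<phi> (f b)) (map_ext \<phi> (f b'))"
        using inj[of b _ b'] by (cases "f b"; cases "f b'") auto
    qed (use f in \<open>simp add: partial_hom_def\<close>)
    show "preserves_op B (\<lambda>b. map_ext \<phi> (f b)) (mult A) (ext_mult K)"
    proof (rule op)
      fix b b' assume "b \<in> B" "b' \<in> B"
      then show "map_ext \<phi> (ext_mult G (f b) (f b')) = ext_mult K (map_ext \<phi> (f b)) (map_ext \<phi> (f b'))"
        using S[of b] S[of b'] by (cases "f b"; cases "f b'") (auto simp: mult)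
    qed (use f in \<open>simp add: partial_hom_def\<close>)
    show "preserves_op B (\<lambda>b. map_ext \<phi> (f b)) (ldiv A) (ext_ldiv K)"
    proof (rule op)
      fix b b' assume "b \<in> B" "b' \<in> B"
      then show "map_ext \<phi> (ext_ldiv G (f b) (f b')) = ext_ldiv K (map_ext \<phi> (f b)) (map_ext \<phi> (f b'))"
        using S[of b] S[of b'] by (cases "f b"; cases "f b'") (auto simp: mult inv)
    qed (use f in \<open>simp add: partial_hom_def\<close>)
    show "preserves_op B (\<lambda>b. map_ext \<phi> (f b)) (rdiv A) (ext_rdiv K)"
    proof (rule op)
      fix b b' assume "b \<in> B" "b' \<in> B"
      then show "map_ext \<phi> (ext_rdiv G (f b) (f b')) = ext_rdiv K (map_ext \<phi> (f b)) (map_ext \<phi> (f b'))"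
        using S[of b] S[of b'] by (cases "f b"; cases "f b'") (auto simp: mult inv)
    qed (use f in \<open>simp add: partial_hom_def\<close>)
  qed
qed

lemma separating_partial_hom_finite_MG:
  assumes A: "A \<in> CMG_variety" and B: "B \<subseteq> carrier A" "finite B"
    and xy: "x \<in> B" "y \<in> B" "x \<noteq> y"
  obtains K :: "nat set monoid" and f where "comm_group K" "finite (carrier K)"
    "partial_hom A B (MG K) f" "f x \<noteq> f y"
proof -
  obtain G :: "nat monoid" and f where G: "group G" and f: "partial_hom A B (MG G) f" "f x \<noteq> f y"
    and comm: "\<And>a b. a \<in> B \<Longrightarrow> b \<in> B \<Longrightarrow> ext_mult G (f a) (f b) = ext_mult G (f b) (f a)"
    using separating_partial_hom_MG[OF assms] by metis
  interpret G: group G by fact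
  define X where "X = {g. Elem g \<in> f ` B}"
  have "finite (Elem ` X)" by (rule finite_subset[of _ "f ` B"]) (use B(2) in \<open>auto simp: X_def\<close>)
  then have finX: "finite X" by (rule finite_imageD) (simp add: inj_on_def)
  have "f ` B \<subseteq> {Bot, Top} \<union> Elem ` carrier G" using f(1) by (simp add: partial_hom_def)
  then have X: "X \<subseteq> carrier G" by (auto simp: X_def)
  have commX: "g \<otimes>\<^bsub>G\<^esub> h = h \<otimes>\<^bsub>G\<^esub> g" if gh: "g \<in> X" "h \<in> X" for g h
  proof -
    obtain a b where "a \<in> B" "b \<in> B" "f a = Elem g" "f b = Elem h"
      using gh unfolding X_def by (metis imageE mem_Collect_eq)
    then show ?thesis using comm[of a b] by simp
  qed
  obtain K :: "nat set monoid" and \<phi> where K: "comm_group K" "finite (carrier K)"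
    and \<phi>: "\<phi> \<in> hom (G\<lparr>carrier := generate G X\<rparr>) K" "inj_on \<phi> X"
    using G.commuting_finite_set_hom_finite_group[OF finX X commX] by metis
  show thesis
  proof (rule that[OF K])
    show "partial_hom A B (MG K) (\<lambda>b. map_ext \<phi> (f b))"
    proof (rule partial_hom_map_ext[OF G G.generate_is_subgroup[OF X] _ \<phi>(1) f(1)])
      show "group K" using K(1) by (rule comm_group.axioms)
      show "{g. Elem g \<in> f ` B} \<subseteq> generate G X" by (auto simp: X_def intro: generate.incl)
      show "inj_on \<phi> {g. Elem g \<in> f ` B}" using \<phi>(2) by (simp add: X_def)
    qed
    have "\<phi> g \<noteq> \<phi> h" if "f x = Elem g" "f y = Elem h" for g h
    proof -
      have "g \<in> X" "h \<in> X" using that xy unfolding X_def by (metis imageI mem_Collect_eq)+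
      then show ?thesis using inj_onD[OF \<phi>(2)] that f(2) by auto
    qed
    then show "map_ext \<phi> (f x) \<noteq> map_ext \<phi> (f y)"
      using f(2) by (cases "f x"; cases "f y") auto
  qed
qed


section \<open>Finite subdirect products\<close>

lemma MG_in_CMG_variety:
  fixes K :: "'g monoid"
  assumes "comm_group K"
  shows "MG K \<in> CMG_variety"
proof -
  interpret comm_group K by fact
  have "ext_mult K x y = ext_mult K y x" if "x \<in> carrier (MG K)" "y \<in> carrier (MG K)" for x y
    using that by (cases x; cases y) (auto simp: m_comm)
  then show ?thesis
    using MG_in_MG_variety[OF is_group] by (simp add: CMG_variety_def)
qed

text \<open>
  The axioms of residuated lattices and all further equations can be checked in each coordinate.
  Residuation is not an equation, but the order is determined coordinatewise as well, since
  \<open>x \<le> y\<close> means \<open>x \<and> y = x\<close>.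
\<close>

lemma subdirect_product_in_CMG_variety:
  fixes C :: "'c rlat" and M :: "'i \<Rightarrow> 'b rlat"
  assumes M: "\<And>i. i \<in> I \<Longrightarrow> M i \<in> CMG_variety"
    and hom: "\<And>i. i \<in> I \<Longrightarrow> partial_hom C (carrier C) (M i) (\<pi> i)"
    and sep: "\<And>x y. x \<in> carrier C \<Longrightarrow> y \<in> carrier C \<Longrightarrow> (\<And>i. i \<in> I \<Longrightarrow> \<pi> i x = \<pi> i y) \<Longrightarrow> x = y"
    and one: "\<one>\<^bsub>C\<^esub> \<in> carrier C"
    and closed: "\<And>x y. x \<in> carrier C \<Longrightarrow> y \<in> carrier C \<Longrightarrow>
      x \<curlywedge>\<^bsub>C\<^esub> y \<in> carrier C \<and> x \<curlyvee>\<^bsub>C\<^esub> y \<in> carrier C \<and> x \<otimes>\<^bsub>C\<^esub> y \<in> carrier C \<and>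
      x \<setminus>\<^bsub>C\<^esub> y \<in> carrier C \<and> x \<sslash>\<^bsub>C\<^esub> y \<in> carrier C"
  shows "C \<in> CMG_variety"
proof -
  have RM: "residuated_lattice (M i)" if "i \<in> I" for i
    using M[OF that] by (simp add: CMG_variety_def MG_variety_def generated_variety_def)
  have monM: "monoid (M i)" if "i \<in> I" for i
    using RM[OF that] by (rule residuated_lattice.axioms)
  note cl = closed[THEN conjunct1] closed[THEN conjunct2, THEN conjunct1]
    closed[THEN conjunct2, THEN conjunct2, THEN conjunct1]
    closed[THEN conjunct2, THEN conjunct2, THEN conjunct2, THEN conjunct1]
    closed[THEN conjunct2, THEN conjunct2, THEN conjunct2, THEN conjunct2]
  have \<pi>: "\<pi> i x \<in> carrier (M i)" if "i \<in> I" "x \<in> carrier C" for i x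
    using hom[OF that(1)] that(2) by (auto simp: partial_hom_def)
  have \<pi>_one: "\<pi> i \<one>\<^bsub>C\<^esub> = \<one>\<^bsub>M i\<^esub>" if "i \<in> I" for i
    using hom[OF that] one by (auto simp: partial_hom_def)
  have \<pi>_op: "\<pi> i (x \<curlywedge>\<^bsub>C\<^esub> y) = \<pi> i x \<curlywedge>\<^bsub>M i\<^esub> \<pi> i y" "\<pi> i (x \<curlyvee>\<^bsub>C\<^esub> y) = \<pi> i x \<curlyvee>\<^bsub>M i\<^esub> \<pi> i y"
    "\<pi> i (x \<otimes>\<^bsub>C\<^esub> y) = \<pi> i x \<otimes>\<^bsub>M i\<^esub> \<pi> i y" "\<pi> i (x \<setminus>\<^bsub>C\<^esub> y) = \<pi> i x \<setminus>\<^bsub>M i\<^esub> \<pi> i y"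
    "\<pi> i (x \<sslash>\<^bsub>C\<^esub> y) = \<pi> i x \<sslash>\<^bsub>M i\<^esub> \<pi> i y"
    if "i \<in> I" "x \<in> carrier C" "y \<in> carrier C" for i x y
    using hom[OF that(1)] that(2,3) cl by (simp_all add: partial_hom_def preserves_op_def)
  note s = \<pi> \<pi>_one \<pi>_op one cl
  have le: "x \<preceq>\<^bsub>C\<^esub> y \<longleftrightarrow> (\<forall>i\<in>I. \<pi> i x \<preceq>\<^bsub>M i\<^esub> \<pi> i y)"
    if "x \<in> carrier C" "y \<in> carrier C" for x y
    unfolding rle_def using sep[of "x \<curlywedge>\<^bsub>C\<^esub> y" x] that by (auto simp: s(3) cl) (metis s(3))
  have "residuated_lattice C"
  proof (intro residuated_lattice.intro residuated_lattice_axioms.intro monoid.intro)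
    fix x y z assume xyz: "x \<in> carrier C" "y \<in> carrier C" "z \<in> carrier C"
    show "x \<otimes>\<^bsub>C\<^esub> y \<otimes>\<^bsub>C\<^esub> z = x \<otimes>\<^bsub>C\<^esub> (y \<otimes>\<^bsub>C\<^esub> z)"
      using xyz by (intro sep) (simp_all add: s monoid.m_assoc[OF monM])
    show "x \<curlywedge>\<^bsub>C\<^esub> y \<curlywedge>\<^bsub>C\<^esub> z = x \<curlywedge>\<^bsub>C\<^esub> (y \<curlywedge>\<^bsub>C\<^esub> z)"
      using xyz by (intro sep) (simp_all add: s residuated_lattice.meet_assoc[OF RM])
    show "x \<curlyvee>\<^bsub>C\<^esub> y \<curlyvee>\<^bsub>C\<^esub> z = x \<curlyvee>\<^bsub>C\<^esub> (y \<curlyvee>\<^bsub>C\<^esub> z)"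
      using xyz by (intro sep) (simp_all add: s residuated_lattice.join_assoc[OF RM])
    show "x \<otimes>\<^bsub>C\<^esub> y \<preceq>\<^bsub>C\<^esub> z \<longleftrightarrow> y \<preceq>\<^bsub>C\<^esub> x \<setminus>\<^bsub>C\<^esub> z"
      using xyz by (simp add: le s residuated_lattice.ldiv_residuation[OF RM])
    show "x \<otimes>\<^bsub>C\<^esub> y \<preceq>\<^bsub>C\<^esub> z \<longleftrightarrow> x \<preceq>\<^bsub>C\<^esub> z \<sslash>\<^bsub>C\<^esub> y"
      using xyz by (simp add: le s residuated_lattice.rdiv_residuation[OF RM])
  next
    fix x y assume xy: "x \<in> carrier C" "y \<in> carrier C"
    show "x \<curlywedge>\<^bsub>C\<^esub> y = y \<curlywedge>\<^bsub>C\<^esub> x"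
      using xy by (intro sep) (simp_all add: s residuated_lattice.meet_comm[OF RM])
    show "x \<curlyvee>\<^bsub>C\<^esub> y = y \<curlyvee>\<^bsub>C\<^esub> x"
      using xy by (intro sep) (simp_all add: s residuated_lattice.join_comm[OF RM])
    show "x \<curlywedge>\<^bsub>C\<^esub> (x \<curlyvee>\<^bsub>C\<^esub> y) = x"
      using xy by (intro sep) (simp_all add: s residuated_lattice.meet_join_absorb[OF RM])
    show "x \<curlyvee>\<^bsub>C\<^esub> (x \<curlywedge>\<^bsub>C\<^esub> y) = x"
      using xy by (intro sep) (simp_all add: s residuated_lattice.join_meet_absorb[OF RM])
  next
    fix x assume x: "x \<in> carrier C"
    show "\<one>\<^bsub>C\<^esub> \<otimes>\<^bsub>C\<^esub> x = x"
      using x by (intro sep) (simp_all add: s monoid.l_one[OF monM])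
    show "x \<otimes>\<^bsub>C\<^esub> \<one>\<^bsub>C\<^esub> = x"
      using x by (intro sep) (simp_all add: s monoid.r_one[OF monM])
  qed (simp_all add: cl one)
  then interpret C: residuated_lattice C .
  have reval: "\<pi> i (reval C v t) = reval (M i) (\<lambda>n. \<pi> i (v n)) t"
    if "i \<in> I" "range v \<subseteq> carrier C" for i v t
  proof (induction t)
    case (RVar n)
    show ?case by simp
  qed (simp_all add: s that C.reval_closed)
  have "C \<Turnstile> e" if e: "\<And>i. i \<in> I \<Longrightarrow> M i \<Turnstile> e" for e
    unfolding satisfies_def
  proof (intro allI impI)
    fix v :: "nat \<Rightarrow> 'c" assume v: "range v \<subseteq> carrier C"
    show "reval C v (fst e) = reval C v (snd e)"
    proof (rule sep)
      fix i assume i: "i \<in> I"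
      have "range (\<lambda>n. \<pi> i (v n)) \<subseteq> carrier (M i)" using \<pi>[OF i] v by auto
      then show "\<pi> i (reval C v (fst e)) = \<pi> i (reval C v (snd e))"
        using e[OF i] by (simp add: reval i v satisfies_def)
    qed (simp_all add: C.reval_closed v)
  qed
  then have "C \<in> MG_variety"
    using M \<open>residuated_lattice C\<close>
    unfolding CMG_variety_def MG_variety_def generated_variety_def by blast
  moreover have "x \<otimes>\<^bsub>C\<^esub> y = y \<otimes>\<^bsub>C\<^esub> x" if "x \<in> carrier C" "y \<in> carrier C" for x y
    using that M by (intro sep) (simp_all add: s CMG_variety_def)
  ultimately show ?thesis by (simp add: CMG_variety_def)
qed

text \<open>
  The product of the \<open>M i\<close> is finite, so it can be copied along an injection \<open>h\<close> to an algebra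
  on natural numbers; the coordinates of the copy make it a subdirect product.
\<close>

lemma finite_jointly_injective_partial_homs:
  fixes A :: "'a rlat" and M :: "'i \<Rightarrow> 'b rlat"
  assumes I: "finite I" and M: "\<And>i. i \<in> I \<Longrightarrow> M i \<in> CMG_variety \<and> finite (carrier (M i))"
    and f: "\<And>i. i \<in> I \<Longrightarrow> partial_hom A B (M i) (f i)"
    and sep: "\<And>x y. x \<in> B \<Longrightarrow> y \<in> B \<Longrightarrow> (\<And>i. i \<in> I \<Longrightarrow> f i x = f i y) \<Longrightarrow> x = y"
  shows "\<exists>(C :: nat rlat) g. C \<in> CMG_variety \<and> finite (carrier C) \<and> partial_embedding A B C g"
proof -
  define P where "P = (\<Pi>\<^sub>E i\<in>I. carrier (M i))"
  have finP: "finite P" unfolding P_def using I M by (intro finite_PiE) auto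
  then obtain h :: "_ \<Rightarrow> nat" where h: "inj_on h P"
    using finite_imp_inj_to_nat_seg by metis
  define k where "k = inv_into P h"
  have kh: "k (h p) = p" if "p \<in> P" for p using that h by (simp add: k_def)
  have Pmem: "p i \<in> carrier (M i)" if "p \<in> P" "i \<in> I" for p i using that by (auto simp: P_def)
  define lift where "lift q a b = h (\<lambda>i\<in>I. q i (k a i) (k b i))"
    for q :: "'i \<Rightarrow> 'b \<Rightarrow> 'b \<Rightarrow> 'b" and a b
  define C where "C = \<lparr>carrier = h ` P, mult = lift (\<lambda>i. mult (M i)), one = h (\<lambda>i\<in>I. \<one>\<^bsub>M i\<^esub>),
    rmeet = lift (\<lambda>i. rmeet (M i)), rjoin = lift (\<lambda>i. rjoin (M i)),
    ldiv = lift (\<lambda>i. ldiv (M i)), rdiv = lift (\<lambda>i. rdiv (M i))\<rparr>"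
  have RM: "residuated_lattice (M i)" if "i \<in> I" for i
    using M[OF that] by (simp add: CMG_variety_def MG_variety_def generated_variety_def)
  have monM: "monoid (M i)" if "i \<in> I" for i
    using RM[OF that] by (rule residuated_lattice.axioms)
  define stable where "stable q \<longleftrightarrow>
    (\<forall>i\<in>I. \<forall>x\<in>carrier (M i). \<forall>y\<in>carrier (M i). q i x y \<in> carrier (M i))"
    for q :: "'i \<Rightarrow> 'b \<Rightarrow> 'b \<Rightarrow> 'b"
  have stable: "stable (\<lambda>i. rmeet (M i))" "stable (\<lambda>i. rjoin (M i))" "stable (\<lambda>i. mult (M i))"
    "stable (\<lambda>i. ldiv (M i))" "stable (\<lambda>i. rdiv (M i))"
    by (simp_all add: stable_def monoid.m_closed[OF monM] residuated_lattice.meet_closed[OF RM]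
        residuated_lattice.join_closed[OF RM] residuated_lattice.ldiv_closed[OF RM]
        residuated_lattice.rdiv_closed[OF RM])
  have liftP: "(\<lambda>i\<in>I. q i (p i) (p' i)) \<in> P" if "stable q" "p \<in> P" "p' \<in> P" for q p p'
    using that Pmem by (simp add: P_def stable_def)
  have lift_closed: "lift q a b \<in> h ` P" if "stable q" "a \<in> h ` P" "b \<in> h ` P" for q a b
    using that liftP[OF that(1)] by (auto simp: lift_def kh)
  have oneP: "(\<lambda>i\<in>I. \<one>\<^bsub>M i\<^esub>) \<in> P" using monoid.one_closed[OF monM] by (auto simp: P_def)
  have "C \<in> CMG_variety"
  proof (rule subdirect_product_in_CMG_variety[of I M C "\<lambda>i a. k a i"])
    fix i assume i: "i \<in> I"
    then show "M i \<in> CMG_variety" using M by blast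
    have op: "preserves_op (h ` P) (\<lambda>a. k a i) (lift q) (q i)" if "stable q" for q
      using i by (simp add: preserves_op_def lift_def kh liftP[OF that])
    show "partial_hom C (carrier C) (M i) (\<lambda>a. k a i)"
      unfolding partial_hom_def
    proof (intro conjI)
      show "(\<lambda>a. k a i) ` carrier C \<subseteq> carrier (M i)" using i by (auto simp: C_def kh Pmem)
      show "\<one>\<^bsub>C\<^esub> \<in> carrier C \<longrightarrow> k \<one>\<^bsub>C\<^esub> i = \<one>\<^bsub>M i\<^esub>" using i oneP by (simp add: C_def kh)
    qed (simp_all add: C_def op[OF stable(1)] op[OF stable(2)] op[OF stable(3)] op[OF stable(4)]
        op[OF stable(5)])
  next
    fix x y assume "x \<in> carrier C" "y \<in> carrier C" and eq: "\<And>i. i \<in> I \<Longrightarrow> k x i = k y i"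
    then obtain p q where pq: "p \<in> P" "q \<in> P" "x = h p" "y = h q" by (auto simp: C_def)
    then have "p = q"
      using eq by (auto simp: kh P_def intro: PiE_ext)
    then show "x = y" using pq by simp
  qed (simp_all add: C_def oneP lift_closed stable)
  moreover have "finite (carrier C)" using finP by (simp add: C_def)
  moreover have "partial_embedding A B C (\<lambda>b. h (\<lambda>i\<in>I. f i b))"
  proof -
    have fP: "(\<lambda>i\<in>I. f i b) \<in> P" if "b \<in> B" for b
      using f that by (auto simp: P_def partial_hom_def)
    have op: "preserves_op B (\<lambda>b. h (\<lambda>i\<in>I. f i b)) p (lift q)"
      if "\<And>i. i \<in> I \<Longrightarrow> preserves_op B (f i) p (q i)" for p q
      unfolding preserves_op_def lift_def
    proof (intro ballI impI arg_cong[of _ _ h] restrict_ext)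
      fix x y i assume "x \<in> B" "y \<in> B" "p x y \<in> B" "i \<in> I"
      then show "f i (p x y) = q i (k (h (\<lambda>i\<in>I. f i x)) i) (k (h (\<lambda>i\<in>I. f i y)) i)"
        using that by (simp add: kh fP preserves_op_def)
    qed
    have "inj_on (\<lambda>b. h (\<lambda>i\<in>I. f i b)) B"
    proof (rule inj_onI, rule sep)
      fix x y i assume "x \<in> B" "y \<in> B" "i \<in> I" "h (\<lambda>i\<in>I. f i x) = h (\<lambda>i\<in>I. f i y)"
      then show "f i x = f i y" using kh fP by (metis restrict_apply')
    qed
    moreover have "\<one>\<^bsub>A\<^esub> \<in> B \<longrightarrow> h (\<lambda>i\<in>I. f i \<one>\<^bsub>A\<^esub>) = \<one>\<^bsub>C\<^esub>"
      using f by (auto simp: C_def partial_hom_def intro!: arg_cong[of _ _ h] restrict_ext)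
    ultimately show ?thesis
      using f fP unfolding partial_embedding_def
      by (auto simp: C_def partial_hom_def intro!: op)
  qed
  ultimately show ?thesis by blast
qed


section \<open>The finite embeddability property\<close>

theorem theorem5p1:
  fixes A :: "'a rlat" and B :: "'a set"
  assumes "A \<in> CMG_variety" and "B \<subseteq> carrier A" and "finite B"
  shows "\<exists>(C :: nat rlat) f. C \<in> CMG_variety \<and> finite (carrier C) \<and> partial_embedding A B C f"
proof -
  define I where "I = {(x, y) \<in> B \<times> B. x \<noteq> y}"
  have "\<exists>(K :: nat set monoid) f. comm_group K \<and> finite (carrier K) \<and>
      partial_hom A B (MG K) f \<and> f (fst i) \<noteq> f (snd i)" if "i \<in> I" for i
  proof -
    have "fst i \<in> B" "snd i \<in> B" "fst i \<noteq> snd i" using that by (auto simp: I_def)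
    from separating_partial_hom_finite_MG[OF assms this] show ?thesis by blast
  qed
  then obtain K :: "'a \<times> 'a \<Rightarrow> nat set monoid" and f where
    K: "\<And>i. i \<in> I \<Longrightarrow> comm_group (K i) \<and> finite (carrier (K i))"
    and f: "\<And>i. i \<in> I \<Longrightarrow> partial_hom A B (MG (K i)) (f i) \<and> f i (fst i) \<noteq> f i (snd i)"
    by metis
  show ?thesis
  proof (rule finite_jointly_injective_partial_homs[of I "\<lambda>i. MG (K i)"])
    show "finite I" by (rule finite_subset[of _ "B \<times> B"]) (use assms(3) in \<open>auto simp: I_def\<close>)
  next
    fix i assume "i \<in> I"
    then show "MG (K i) \<in> CMG_variety \<and> finite (carrier (MG (K i)))"
      and "partial_hom A B (MG (K i)) (f i)"
      using K[of i] f[of i] MG_in_CMG_variety[of "K i"] by simp_all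
  next
    fix x y assume "x \<in> B" "y \<in> B" "\<And>i. i \<in> I \<Longrightarrow> f i x = f i y"
    then show "x = y" using f[of "(x, y)"] by (force simp: I_def)
  qed
qed
end
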